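(* Let $p,q\in(1,\infty)$. a) If $1<p\le2\le q<\infty$, then $(\sigma,w)_{p,q}=[\sigma,w]_{p,q}$ for all Radon measures $\sigma$ and $w$ on $\mathbb{R}^N$. b) If $2<p<\infty$ or $1<q<2$, then there exist Radon measures $\sigma$ and $w$ on $\mathbb{R}^N$ such that $(\sigma,w)_{p,q}<\infty$ but $[\sigma,w]_{p,q}=\infty$.
   Context: A dyadic lattice $\mathscr{D}=\bigcup_{k\in\mathbb{Z}}\mathscr{D}_k$ on $\mathbb{R}^N$ is fixed: each $\mathscr{D}_k$ is a disjoint cover of $\mathbb{R}^N$ by cubes of the form $x+[0,2^{-k})^N$, and every cube in $\mathscr{D}_k$ is a union of $2^N$ cubes of $\mathscr{D}_{k+1}$. $|Q|$ is the Lebesgue measure of $Q$, and $p'$ is the Hölder conjugate of $p$. The simple (Muckenhoupt type) $A_{p,q}$-constant is $$(\sigma,w)_{p,q}:=\sup_{Q\in\mathscr{D}}\frac{\sigma(Q)^{1/p'}w(Q)^{1/q}}{|Q|}.$$ The quadratic $\mathscr{A}_{p,q}$-constant $[\sigma,w]_{p,q}\in[0,\infty]$ is the best constant such that for every collection $\{a_Q\}_{Q\in\mathscr{D}}\subset\mathbb{R}$ $$\Big\|\Big(\sum_{Q\in\mathscr{D}}\Big(a_Q\frac{\sigma(Q)}{|Q|}\Big)^21_Q\Big)^{1/2}\Big\|_{L^q(w)}\le[\sigma,w]_{p,q}\Big\|\Big(\sum_{Q\in\mathscr{D}}a_Q^21_Q\Big)^{1/2}\Big\|_{L^p(\sigma)}.$$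 *)

theory Defs
  imports "HOL-Analysis.Analysis"
begin

definition half_open_cube :: "real ^ 'n \<Rightarrow> real \<Rightarrow> (real ^ 'n) set" where
  "half_open_cube x l = {y. \<forall>i. x $ i \<le> y $ i \<and> y $ i < x $ i + l}"

definition dyadic_lattice :: "(int \<Rightarrow> (real ^ 'n) set set) \<Rightarrow> bool" where
  "dyadic_lattice D \<longleftrightarrow>
     (\<forall>k. partition_on UNIV (D k)) \<and>
     (\<forall>k. \<forall>Q\<in>D k. \<exists>x. Q = half_open_cube x (2 powi (- k))) \<and>
     (\<forall>k. \<forall>Q\<in>D k. \<exists>\<C>\<subseteq>D (k + 1). card \<C> = 2 ^ CARD('n) \<and> Q = \<Union>\<C>)"

definition dyadic_cubes :: "(int \<Rightarrow> (real ^ 'n) set set) \<Rightarrow> (real ^ 'n) set set" where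
  "dyadic_cubes D = (\<Union>k. D k)"

definition radon_measure :: "'a::topological_space measure \<Rightarrow> bool" where
  "radon_measure M \<longleftrightarrow>
     sets M = sets borel \<and>
     (\<forall>K. compact K \<longrightarrow> emeasure M K < \<infinity>) \<and>
     (\<forall>B\<in>sets borel. emeasure M B = (SUP K\<in>{K. K \<subseteq> B \<and> compact K}. emeasure M K))"

text \<open>Powers of \<^typ>\<open>ennreal\<close>, only meant for exponents \<open>r > 0\<close>
  (so that \<open>0\<close> has power \<open>0\<close> and \<open>\<infinity>\<close> has power \<open>\<infinity>\<close>).\<close>

definition ennreal_powr :: "ennreal \<Rightarrow> real \<Rightarrow> ennreal" where
  "ennreal_powr x r = (if x = \<infinity> then \<infinity> else ennreal (enn2real x powr r))"

definition Lp_norm :: "'a measure \<Rightarrow> real \<Rightarrow> ('a \<Rightarrow> ennreal) \<Rightarrow> ennreal" where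
  "Lp_norm M r f = ennreal_powr (\<integral>\<^sup>+x. ennreal_powr (f x) r \<partial>M) (1 / r)"

definition hoelder_conjugate :: "real \<Rightarrow> real" where
  "hoelder_conjugate p = p / (p - 1)"

text \<open>Dyadic cubes are bounded, hence have finite measure under Lebesgue measure and every Radon
  measure; the real-valued \<^const>\<open>measure\<close> therefore loses nothing below.\<close>

definition simple_A_const ::
  "(int \<Rightarrow> (real ^ 'n) set set) \<Rightarrow> real \<Rightarrow> real \<Rightarrow>
   (real ^ 'n) measure \<Rightarrow> (real ^ 'n) measure \<Rightarrow> ennreal" where
  "simple_A_const D p q \<sigma> w =
     (SUP Q\<in>dyadic_cubes D.
        ennreal (measure \<sigma> Q powr (1 / hoelder_conjugate p) * measure w Q powr (1 / q)
                 / measure lborel Q))"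

definition square_function ::
  "(int \<Rightarrow> (real ^ 'n) set set) \<Rightarrow> ((real ^ 'n) set \<Rightarrow> real) \<Rightarrow> real ^ 'n \<Rightarrow> ennreal" where
  "square_function D c x =
     ennreal_powr (\<Sum>\<^sub>\<infinity>Q\<in>dyadic_cubes D. ennreal ((c Q)\<^sup>2 * indicator Q x)) (1 / 2)"

text \<open>Families indexed by the dyadic cubes are functions on all sets; values off
  \<^const>\<open>dyadic_cubes\<close> are irrelevant.  The constant \<open>C = \<infinity>\<close> is allowed, and
  \<open>\<infinity> * 0 = 0\<close> in \<^typ>\<open>ennreal\<close>.\<close>

definition quadratic_A_const ::
  "(int \<Rightarrow> (real ^ 'n) set set) \<Rightarrow> real \<Rightarrow> real \<Rightarrow>
   (real ^ 'n) measure \<Rightarrow> (real ^ 'n) measure \<Rightarrow> ennreal" where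
  "quadratic_A_const D p q \<sigma> w =
     Inf {C. \<forall>a :: (real ^ 'n) set \<Rightarrow> real.
            Lp_norm w q (square_function D (\<lambda>Q. a Q * (measure \<sigma> Q / measure lborel Q)))
              \<le> C * Lp_norm \<sigma> p (square_function D a)}"

end

theory Submission
  imports Defs
begin

text \<open>
  Both sides of the quadratic inequality are norms of square functions, that is, norms of the series
  \<open>\<Sum>\<^sub>Q c\<^sub>Q\<^sup>2 1\<^sub>Q\<close> with exponent \<open>q / 2\<close> or \<open>p / 2\<close>. The simple constant compares the two sides for each single
  cube; so it is at most the quadratic one, and the question is whether the sum over the cubes can be
  moved through the norms. For \<open>q / 2 \<ge> 1\<close> Minkowski's inequality moves it out on the left, and for
  \<open>p / 2 \<le> 1\<close> the reversed inequality moves it in on the right. This gives equality for \<open>p \<le> 2 \<le> q\<close>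
  (\<open>simple_le_quadratic\<close>, \<open>quadratic_le_simple\<close>). Both directions of Minkowski's inequality
  (\<open>Minkowski_finite\<close>) follow from Jensen's inequality with weights proportional to the norms.

  When one of the exponents is on the wrong side of \<open>2\<close>, consider only the cubes \<open>Q\<^sub>0 \<supset> Q\<^sub>1 \<supset> \<dots>\<close> that contain
  the origin, with \<open>|Q\<^sub>k| = 2 powr (- N * k)\<close>. Let one measure be a point mass at the origin, which lies in all \<open>Q\<^sub>k\<close>, and
  the other one a sum of point masses, one in each layer \<open>Q\<^sub>k - Q\<^sub>k\<^sub>+\<^sub>1\<close>, of mass \<open>|Q\<^sub>k|\<close> to the power \<open>s\<close>. The choices
  \<open>s = p'\<close> for \<open>\<sigma>\<close> and \<open>s = q\<close> for \<open>w\<close> are those for which the quotients in the simple constant stay between two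
  positive bounds on all \<open>Q\<^sub>k\<close>; finiteness comes from \<open>layer_measure_growth\<close>.
  The point mass turns a square function into an \<open>\<ell>\<^sup>2\<close> norm of the normalised coefficients, whereas the decaying layers separate the scales and turn it into an \<open>\<ell>\<^sup>p\<close> norm, or \<open>\<ell>\<^sup>q\<close>
  norm. If \<open>p > 2\<close>, or \<open>q < 2\<close>, these norms are not comparable in the required direction, and a power of the harmonic
  sequence shows that no finite constant exists (\<open>counterexample_large_p\<close>, \<open>counterexample_small_q\<close>).
\<close>

section \<open>Powers of extended nonnegative reals\<close>

lemma ennreal_powr_ennreal: "0 \<le> x \<Longrightarrow> ennreal_powr (ennreal x) r = ennreal (x powr r)"
  by (simp add: ennreal_powr_def)

lemma ennreal_powr_top [simp]: "ennreal_powr \<infinity> r = \<infinity>" "ennreal_powr top r = top"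
  by (simp_all add: ennreal_powr_def)

lemma ennreal_powr_0 [simp]: "ennreal_powr 0 r = 0"
  by (simp add: ennreal_powr_def)

lemma ennreal_powr_one [simp]: "ennreal_powr x 1 = x"
  by (cases x) (auto simp: ennreal_powr_def)

lemma ennreal_powr_less_top_iff [simp]: "ennreal_powr x r < top \<longleftrightarrow> x < top"
  by (cases x) (auto simp: ennreal_powr_def)

lemma ennreal_powr_powr: "ennreal_powr (ennreal_powr x r) s = ennreal_powr x (r * s)"
  by (cases x) (auto simp: ennreal_powr_def powr_powr)

lemma ennreal_powr_mult_ennreal:
  assumes "0 < c" shows "ennreal_powr (ennreal c * x) r = ennreal (c powr r) * ennreal_powr x r"
proof (cases x)
  case (real y)
  then show ?thesis using assms
    by (simp add: ennreal_powr_ennreal powr_mult flip: ennreal_mult)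
next
  case top
  then show ?thesis using assms by (simp add: ennreal_mult_top)
qed

lemma ennreal_powr_mono:
  assumes "x \<le> y" "0 < r" shows "ennreal_powr x r \<le> ennreal_powr y r"
proof (cases y)
  case (real b)
  with assms obtain a where "x = ennreal a" "0 \<le> a" by (cases x) (auto simp: top_unique)
  with real assms show ?thesis
    by (auto simp: ennreal_powr_ennreal intro!: ennreal_leI powr_mono2)
qed auto

text \<open>
  Power functions are order isomorphisms, so they commute with suprema; this is what lets inequalities
  for finite sums pass to series.
\<close>

lemma ennreal_powr_le_iff:
  assumes "0 < r"
  shows "ennreal_powr x r \<le> y \<longleftrightarrow> x \<le> ennreal_powr y (1 / r)"
  using ennreal_powr_mono[of "ennreal_powr x r" y "1/r"]
    ennreal_powr_mono[of x "ennreal_powr y (1/r)" r] assms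
  by (auto simp: ennreal_powr_powr)

lemma ennreal_powr_SUP:
  assumes "0 < r"
  shows "ennreal_powr (SUP i\<in>I. f i) r = (SUP i\<in>I. ennreal_powr (f i) r)"
proof -
  have "ennreal_powr (SUP i\<in>I. f i) r \<le> y \<longleftrightarrow> (SUP i\<in>I. ennreal_powr (f i) r) \<le> y" for y
    by (simp add: ennreal_powr_le_iff[OF assms] SUP_le_iff)
  then show ?thesis by (meson order_antisym order_refl)
qed

lemma measurable_ennreal_powr [measurable]:
  assumes [measurable]: "f \<in> borel_measurable M"
  shows "(\<lambda>x. ennreal_powr (f x) r) \<in> borel_measurable M"
  unfolding ennreal_powr_def by measurable

section \<open>The Minkowski inequality on both sides of the exponent one\<close>

lemma Bernoulli_powr_ge:
  fixes r u :: real
  assumes "1 \<le> r" "0 \<le> u" shows "1 + r * (u - 1) \<le> u powr r"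
proof (cases "u = 0")
  case False
  have "u powr r \<ge> 1 powr r + (r * 1 powr (r - 1)) * (u - 1)"
  proof -
    have "u powr r - 1 powr r \<ge> (r * 1 powr (r - 1)) * (u - 1)"
    proof (rule convex_on_imp_above_tangent[where A = "{0<..}"])
      show "((\<lambda>x. x powr r) has_field_derivative r * 1 powr (r - 1)) (at 1 within {0<..})"
        by (auto intro!: derivative_eq_intros)
    qed (use assms False in \<open>auto intro: powr_convex simp: interior_open\<close>)
    then show ?thesis by linarith
  qed
  then show ?thesis by simp
qed (use assms in auto)

text \<open>
  Bernoulli's inequality for the exponent \<open>1 / r \<ge> 1\<close>, applied at \<open>u powr r\<close>.
\<close>

lemma Bernoulli_powr_le:
  fixes r u :: real
  assumes "0 < r" "r \<le> 1" "0 \<le> u" shows "u powr r \<le> 1 + r * (u - 1)"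
proof -
  have "1 + (1 / r) * (u powr r - 1) \<le> (u powr r) powr (1 / r)"
    by (rule Bernoulli_powr_ge) (use assms in auto)
  also have "\<dots> = u" using assms by (simp add: powr_powr)
  finally show ?thesis using assms by (simp add: field_simps)
qed

text \<open>
  Jensen's inequality for the power function, with the weights \<open>n i / S\<close> at the points \<open>u i / n i\<close>, and
  multiplied out. The points are rescaled to \<open>v i\<close> of weighted mean \<open>1\<close>, where the tangent line of the
  power function is the right-hand side of Bernoulli's inequality; its linear part averages to zero.
  Convexity or concavity decides the direction.
\<close>

lemma Jensen_powr_homogeneous:
  fixes r :: real and n u :: "'i \<Rightarrow> real"
  assumes F: "finite F" and n: "\<And>i. i \<in> F \<Longrightarrow> 0 < n i" and u: "\<And>i. i \<in> F \<Longrightarrow> 0 \<le> u i"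
  defines "S \<equiv> sum n F" and "T \<equiv> sum u F"
  shows "1 \<le> r \<Longrightarrow> T powr r \<le> S powr (r - 1) * (\<Sum>i\<in>F. n i powr (1 - r) * u i powr r)" (is "_ \<Longrightarrow> ?A")
    and "0 < r \<Longrightarrow> r \<le> 1 \<Longrightarrow> S powr (r - 1) * (\<Sum>i\<in>F. n i powr (1 - r) * u i powr r) \<le> T powr r" (is "_ \<Longrightarrow> _ \<Longrightarrow> ?B")
proof -
  consider "T = 0" | "0 < T" using u sum_nonneg[of F u] unfolding T_def by force
  then have "(1 \<le> r \<longrightarrow> ?A) \<and> (0 < r \<longrightarrow> r \<le> 1 \<longrightarrow> ?B)"
  proof cases
    case 1
    then have "\<forall>i\<in>F. u i = 0" using F u by (simp add: T_def sum_nonneg_eq_0_iff)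
    then show ?thesis using 1 by (auto intro!: sum_nonneg mult_nonneg_nonneg)
  next
    case 2
    then have "F \<noteq> {}" by (auto simp: T_def)
    then have S: "0 < S" unfolding S_def using F n by (intro sum_pos) auto
    \<comment> \<open>Normalised so that the mean of \<open>v\<close> with weights \<open>n i / S\<close> is \<open>1\<close>, the point where the tangent is taken.\<close>
    define v where "v i = S * u i / (n i * T)" for i
    have v: "0 \<le> v i" if "i \<in> F" for i using n[OF that] u[OF that] S 2 by (simp add: v_def)
    have nv: "n i * v i = u i * (S / T)" if "i \<in> F" for i
      using n[OF that] 2 by (simp add: v_def field_simps)
    have lin: "(\<Sum>i\<in>F. n i * (1 + r * (v i - 1))) = S"
    proof -
      have "(\<Sum>i\<in>F. n i * (1 + r * (v i - 1))) = (\<Sum>i\<in>F. (1 - r) * n i + r * (n i * v i))"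
        by (intro sum.cong) (auto simp: algebra_simps)
      also have "\<dots> = (1 - r) * S + r * (\<Sum>i\<in>F. n i * v i)"
        by (simp add: sum.distrib sum_distrib_left S_def)
      also have "(\<Sum>i\<in>F. n i * v i) = T * (S / T)"
        unfolding T_def sum_distrib_right by (intro sum.cong) (auto simp: nv T_def)
      finally show ?thesis using 2 by (simp add: algebra_simps)
    qed
    have pow: "(\<Sum>i\<in>F. n i * v i powr r) = S powr r / T powr r * (\<Sum>i\<in>F. n i powr (1 - r) * u i powr r)"
      unfolding sum_distrib_left
    proof (intro sum.cong refl)
      fix i assume i: "i \<in> F"
      show "n i * v i powr r = S powr r / T powr r * (n i powr (1 - r) * u i powr r)"
        using n[OF i] u[OF i] S 2
        by (simp add: v_def powr_divide powr_mult powr_diff field_simps)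
    qed
    have SS: "S powr r = S * S powr (r - 1)" using S by (simp add: powr_mult_base)
    have eq: "(\<Sum>i\<in>F. n i * v i powr r) / S * T powr r
                = S powr (r - 1) * (\<Sum>i\<in>F. n i powr (1 - r) * u i powr r)"
      unfolding pow SS using S 2 by (simp add: field_simps)
    have "?A" if "1 \<le> r"
    proof -
      have "(\<Sum>i\<in>F. n i * (1 + r * (v i - 1))) \<le> (\<Sum>i\<in>F. n i * v i powr r)"
        using that n v by (intro sum_mono mult_left_mono Bernoulli_powr_ge) (auto intro: less_imp_le)
      then have "1 * T powr r \<le> (\<Sum>i\<in>F. n i * v i powr r) / S * T powr r"
        using S unfolding lin by (intro mult_right_mono) (auto simp: field_simps)
      then show ?thesis unfolding eq by simp
    qed
    moreover have "?B" if "0 < r" "r \<le> 1"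
    proof -
      have "(\<Sum>i\<in>F. n i * v i powr r) \<le> (\<Sum>i\<in>F. n i * (1 + r * (v i - 1)))"
        using that n v by (intro sum_mono mult_left_mono Bernoulli_powr_le) (auto intro: less_imp_le)
      then have "(\<Sum>i\<in>F. n i * v i powr r) / S * T powr r \<le> 1 * T powr r"
        using S unfolding lin by (intro mult_right_mono) (auto simp: field_simps)
      then show ?thesis unfolding eq by simp
    qed
    ultimately show ?thesis by blast
  qed
  then show "1 \<le> r \<Longrightarrow> ?A" "0 < r \<Longrightarrow> r \<le> 1 \<Longrightarrow> ?B" by auto
qed

text \<open>
  With the norms \<open>N i\<close> in the place of \<open>n i\<close>, the right-hand side of the pointwise Jensen inequality integrates to
  exactly \<open>S powr r\<close>. One computation therefore yields the triangle inequality for \<open>r \<ge> 1\<close> and its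
  reversal for \<open>r \<le> 1\<close>.
\<close>

lemma Minkowski_finite:
  fixes f :: "'i \<Rightarrow> 'a \<Rightarrow> real" and N :: "'i \<Rightarrow> real"
  assumes F: "finite F" and [measurable]: "\<And>i. i \<in> F \<Longrightarrow> f i \<in> borel_measurable M"
    and f0: "\<And>i x. i \<in> F \<Longrightarrow> 0 \<le> f i x" and N0: "\<And>i. i \<in> F \<Longrightarrow> 0 < N i"
    and N: "\<And>i. i \<in> F \<Longrightarrow> (\<integral>\<^sup>+x. ennreal (f i x powr r) \<partial>M) = ennreal (N i powr r)"
  shows "1 \<le> r \<Longrightarrow> (\<integral>\<^sup>+x. ennreal ((\<Sum>i\<in>F. f i x) powr r) \<partial>M) \<le> ennreal ((\<Sum>i\<in>F. N i) powr r)" (is "_ \<Longrightarrow> ?A")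
    and "0 < r \<Longrightarrow> r \<le> 1 \<Longrightarrow> ennreal ((\<Sum>i\<in>F. N i) powr r) \<le> (\<integral>\<^sup>+x. ennreal ((\<Sum>i\<in>F. f i x) powr r) \<partial>M)" (is "_ \<Longrightarrow> _ \<Longrightarrow> ?B")
proof -
  define S where "S = sum N F"
  have S0: "0 \<le> S" unfolding S_def using N0 by (intro sum_nonneg) (auto intro: less_imp_le)
  define g where "g x = S powr (r - 1) * (\<Sum>i\<in>F. N i powr (1 - r) * f i x powr r)" for x
  have "(\<integral>\<^sup>+x. ennreal (g x) \<partial>M)
      = (\<integral>\<^sup>+x. ennreal (S powr (r - 1)) * (\<Sum>i\<in>F. ennreal (N i powr (1 - r)) * ennreal (f i x powr r)) \<partial>M)"
    by (intro nn_integral_cong) (simp add: g_def ennreal_mult sum_nonneg flip: sum_ennreal)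
  also have "\<dots> = ennreal (S powr (r - 1)) * (\<Sum>i\<in>F. ennreal (N i powr (1 - r)) * ennreal (N i powr r))"
    by (subst nn_integral_cmult, measurable, subst nn_integral_sum)
      (auto simp: nn_integral_cmult N intro!: arg_cong[where f = "\<lambda>t. _ * t"] sum.cong)
  also have "(\<Sum>i\<in>F. ennreal (N i powr (1 - r)) * ennreal (N i powr r)) = ennreal S"
  proof -
    have "ennreal (N i powr (1 - r)) * ennreal (N i powr r) = ennreal (N i)" if "i \<in> F" for i
      using N0[OF that] by (simp flip: ennreal_mult powr_add)
    then show ?thesis using N0 by (simp add: S_def sum_ennreal less_imp_le)
  qed
  also have "ennreal (S powr (r - 1)) * ennreal S = ennreal (S powr r)"
    using S0 by (simp add: mult.commute powr_mult_base flip: ennreal_mult)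
  finally have g: "(\<integral>\<^sup>+x. ennreal (g x) \<partial>M) = ennreal (S powr r)" .
  show "1 \<le> r \<Longrightarrow> ?A"
    unfolding g[symmetric, unfolded S_def] using Jensen_powr_homogeneous(1)[OF F N0 f0, where r = r]
    by (intro nn_integral_mono ennreal_leI) (simp add: g_def S_def)
  show "0 < r \<Longrightarrow> r \<le> 1 \<Longrightarrow> ?B"
    unfolding g[symmetric, unfolded S_def] using Jensen_powr_homogeneous(2)[OF F N0 f0, where r = r]
    by (intro nn_integral_mono ennreal_leI) (simp add: g_def S_def)
qed

text \<open>
  For multiples of indicators all norms are explicit. Terms of norm zero vanish almost everywhere and are
  discarded, because the finite inequality divides by the norms; the series is then reached
  through its partial sums.
\<close>

lemma Minkowski_sets:
  fixes E :: "nat \<Rightarrow> 'a set" and c :: "nat \<Rightarrow> real"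
  assumes E[measurable]: "\<And>i. E i \<in> sets M" and fin: "\<And>i. emeasure M (E i) < \<infinity>"
    and c: "\<And>i. 0 \<le> c i"
  shows "1 \<le> r \<Longrightarrow> (\<integral>\<^sup>+x. ennreal_powr (\<Sum>i. ennreal (c i * indicator (E i) x)) r \<partial>M)
      \<le> ennreal_powr (\<Sum>i. ennreal (c i * measure M (E i) powr (1 / r))) r" (is "_ \<Longrightarrow> ?A")
    and "0 < r \<Longrightarrow> r \<le> 1 \<Longrightarrow> ennreal_powr (\<Sum>i. ennreal (c i * measure M (E i) powr (1 / r))) r
      \<le> (\<integral>\<^sup>+x. ennreal_powr (\<Sum>i. ennreal (c i * indicator (E i) x)) r \<partial>M)" (is "_ \<Longrightarrow> _ \<Longrightarrow> ?B")
proof -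
  define N where "N i = c i * measure M (E i) powr (1 / r)" for i
  define f where "f i x = c i * indicator (E i) x" for i x
  have f0: "0 \<le> f i x" and N0: "0 \<le> N i" for i x
    using c by (auto simp: f_def N_def)
  have [measurable]: "f i \<in> borel_measurable M" for i unfolding f_def by measurable
  define F where "F n = {i. i < n \<and> 0 < N i}" for n
  have F: "finite (F n)" for n by (simp add: F_def)
  have SN: "(\<Sum>i<n. N i) = (\<Sum>i\<in>F n. N i)" for n
    by (rule sum.mono_neutral_right) (use N0 in \<open>auto simp: F_def not_less intro: antisym\<close>)
  have Nf: "(\<integral>\<^sup>+x. ennreal (f i x powr r) \<partial>M) = ennreal (N i powr r)" if "0 < r" for i
  proof -
    have "(\<integral>\<^sup>+x. ennreal (f i x powr r) \<partial>M) = (\<integral>\<^sup>+x. ennreal (c i powr r) * indicator (E i) x \<partial>M)"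
      by (intro nn_integral_cong) (auto simp: f_def split: split_indicator)
    also have "\<dots> = ennreal (c i powr r) * emeasure M (E i)" by (simp add: nn_integral_cmult)
    also have "emeasure M (E i) = ennreal (measure M (E i))"
      using fin[of i] by (intro emeasure_eq_ennreal_measure) auto
    finally show ?thesis using that c
      by (simp add: N_def powr_mult powr_powr flip: ennreal_mult)
  qed
  have sumN: "(\<Sum>i. ennreal (N i)) = (SUP n. ennreal (\<Sum>i<n. N i))"
    by (simp add: suminf_eq_SUP N0 sum_ennreal)
  have sumf: "(\<Sum>i. ennreal (f i x)) = (SUP n. ennreal (\<Sum>i<n. f i x))" for x
    by (simp add: suminf_eq_SUP f0 sum_ennreal)
  have powN: "ennreal_powr (\<Sum>i. ennreal (N i)) r = (SUP n. ennreal ((\<Sum>i<n. N i) powr r))" if "0 < r"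
    unfolding sumN by (simp add: ennreal_powr_SUP[OF that] ennreal_powr_ennreal sum_nonneg N0)
  have powf: "ennreal_powr (\<Sum>i. ennreal (f i x)) r = (SUP n. ennreal ((\<Sum>i<n. f i x) powr r))" if "0 < r" for x
    unfolding sumf by (simp add: ennreal_powr_SUP[OF that] ennreal_powr_ennreal sum_nonneg f0)
  show ?A if r: "1 \<le> r"
  proof -
    have ae: "AE x in M. f i x = 0" if "\<not> 0 < N i" for i
    proof -
      have "c i = 0 \<or> emeasure M (E i) = 0"
        using that N0[of i] fin[of i] c[of i]
        by (auto simp: N_def emeasure_eq_ennreal_measure zero_less_mult_iff)
      then show ?thesis
      proof
        assume "emeasure M (E i) = 0"
        then have "AE x in M. x \<notin> E i" by (intro AE_not_in) (simp add: null_sets_def)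
        then show ?thesis by eventually_elim (simp add: f_def)
      qed (simp add: f_def)
    qed
    have fin_le: "(\<integral>\<^sup>+x. ennreal ((\<Sum>i<n. f i x) powr r) \<partial>M) \<le> ennreal ((\<Sum>i<n. N i) powr r)" for n
    proof -
      have "AE x in M. \<forall>i\<in>{i. \<not> 0 < N i}. f i x = 0"
        using ae by (intro AE_ball_countable[THEN iffD2]) auto
      then have "AE x in M. (\<Sum>i<n. f i x) = (\<Sum>i\<in>F n. f i x)"
        by eventually_elim (rule sum.mono_neutral_right, auto simp: F_def)
      then have "(\<integral>\<^sup>+x. ennreal ((\<Sum>i<n. f i x) powr r) \<partial>M) = (\<integral>\<^sup>+x. ennreal ((\<Sum>i\<in>F n. f i x) powr r) \<partial>M)"
        by (intro nn_integral_cong_AE) (auto elim!: eventually_mono)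
      also have "\<dots> \<le> ennreal ((\<Sum>i\<in>F n. N i) powr r)"
        using r by (intro Minkowski_finite(1) F) (auto simp: f0 F_def Nf)
      finally show ?thesis by (simp add: SN)
    qed
    have "(\<integral>\<^sup>+x. (SUP n. ennreal ((\<Sum>i<n. f i x) powr r)) \<partial>M)
        = (SUP n. \<integral>\<^sup>+x. ennreal ((\<Sum>i<n. f i x) powr r) \<partial>M)"
      using r by (intro nn_integral_monotone_convergence_SUP)
        (auto simp: incseq_def le_fun_def intro!: ennreal_leI powr_mono2 sum_nonneg f0 sum_mono2)
    also have "\<dots> \<le> (SUP n. ennreal ((\<Sum>i<n. N i) powr r))"
      by (intro SUP_mono) (use fin_le in auto)
    finally have "(\<integral>\<^sup>+x. ennreal_powr (\<Sum>i. ennreal (f i x)) r \<partial>M) \<le> ennreal_powr (\<Sum>i. ennreal (N i)) r"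
      using r by (simp add: powN powf)
    then show ?thesis by (simp add: f_def N_def)
  qed
  show ?B if r: "0 < r" "r \<le> 1"
  proof -
    have "ennreal ((\<Sum>i<n. N i) powr r) \<le> (\<integral>\<^sup>+x. ennreal_powr (\<Sum>i. ennreal (f i x)) r \<partial>M)" for n
    proof -
      have "ennreal ((\<Sum>i<n. N i) powr r) \<le> (\<integral>\<^sup>+x. ennreal ((\<Sum>i\<in>F n. f i x) powr r) \<partial>M)"
        unfolding SN using r by (intro Minkowski_finite(2) F) (auto simp: f0 F_def Nf)
      also have "\<dots> \<le> (\<integral>\<^sup>+x. ennreal_powr (\<Sum>i. ennreal (f i x)) r \<partial>M)"
      proof (intro nn_integral_mono)
        fix x
        have "ennreal ((\<Sum>i\<in>F n. f i x) powr r) \<le> ennreal ((\<Sum>i<n. f i x) powr r)"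
          using r by (intro ennreal_leI powr_mono2 sum_mono2) (auto simp: f0 sum_nonneg F_def)
        also have "\<dots> \<le> ennreal_powr (\<Sum>i. ennreal (f i x)) r"
          unfolding powf[OF r(1)] by (rule SUP_upper) simp
        finally show "ennreal ((\<Sum>i\<in>F n. f i x) powr r) \<le> ennreal_powr (\<Sum>i. ennreal (f i x)) r" .
      qed
      finally show ?thesis .
    qed
    then have "ennreal_powr (\<Sum>i. ennreal (N i)) r \<le> (\<integral>\<^sup>+x. ennreal_powr (\<Sum>i. ennreal (f i x)) r \<partial>M)"
      using r(1) by (auto simp: powN intro!: SUP_least)
    then show ?thesis by (simp add: f_def N_def)
  qed
qed

section \<open>Dyadic cubes\<close>

lemma half_open_cube_bounds:
  fixes x :: "real ^ 'n"
  shows "box x (x + (\<chi> i. l)) \<subseteq> half_open_cube x l" "half_open_cube x l \<subseteq> cbox x (x + (\<chi> i. l))"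
  by (auto simp: half_open_cube_def mem_box_cart less_imp_le)

lemma borel_half_open_cube [measurable]: "half_open_cube (x :: real ^ 'n) l \<in> sets borel"
  unfolding half_open_cube_def by measurable

lemma measure_half_open_cube:
  fixes x :: "real ^ 'n"
  assumes "0 < l"
  shows "measure lborel (half_open_cube x l) = l ^ CARD('n)"
proof -
  let ?y = "x + (\<chi> i. l) :: real ^ 'n"
  have ne: "cbox x ?y \<noteq> {}" using assms by (auto simp: interval_ne_empty_cart intro: less_imp_le)
  have cb: "measure lborel (cbox x ?y) = l ^ CARD('n)"
    using content_cbox_cart[OF ne] by simp
  have "measure lborel (box x ?y) \<le> measure lborel (half_open_cube x l)"
    by (intro measure_mono_fmeasurable half_open_cube_bounds fmeasurableI2[OF _ half_open_cube_bounds(2)]) auto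
  moreover have "measure lborel (half_open_cube x l) \<le> measure lborel (cbox x ?y)"
    by (intro measure_mono_fmeasurable half_open_cube_bounds) auto
  moreover have "measure lborel (box x ?y) = measure lborel (cbox x ?y)"
    using ne by (simp add: measure_lborel_box_eq measure_lborel_cbox_eq box_ne_empty)
  ultimately show ?thesis using cb by simp
qed

lemma emeasure_radon_half_open_cube:
  assumes "radon_measure (M :: (real ^ 'n) measure)"
  shows "emeasure M (half_open_cube x l) < \<infinity>"
proof -
  have "emeasure M (half_open_cube x l) \<le> emeasure M (cbox x (x + (\<chi> i. l)))"
    using assms by (intro emeasure_mono half_open_cube_bounds) (auto simp: radon_measure_def)
  also have "\<dots> < \<infinity>" using assms compact_cbox unfolding radon_measure_def by blast
  finally show ?thesis .
qed

lemma dyadic_cubeE: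
  assumes "dyadic_lattice D" "Q \<in> D k"
  obtains x where "Q = half_open_cube x (2 powi (- k))"
  using assms unfolding dyadic_lattice_def by metis

lemma measure_dyadic_cube:
  fixes D :: "int \<Rightarrow> (real ^ 'n) set set"
  assumes "dyadic_lattice D" "Q \<in> D k"
  shows "measure lborel Q = (2 powi (- k)) ^ CARD('n)"
  using assms by (elim dyadic_cubeE) (auto intro!: measure_half_open_cube)

lemma dyadic_cube_regular:
  fixes D :: "int \<Rightarrow> (real ^ 'n) set set"
  assumes D: "dyadic_lattice D" and Q: "Q \<in> dyadic_cubes D"
  shows "0 < measure lborel Q" "Q \<in> sets borel"
    "radon_measure M \<Longrightarrow> emeasure M Q < \<infinity>"
proof -
  from Q obtain k where k: "Q \<in> D k" by (auto simp: dyadic_cubes_def)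
  show "0 < measure lborel Q" using measure_dyadic_cube[OF D k] by simp
  show "Q \<in> sets borel" "radon_measure M \<Longrightarrow> emeasure M Q < \<infinity>"
    using borel_half_open_cube emeasure_radon_half_open_cube dyadic_cubeE[OF D k] by metis+
qed

text \<open>
  The cubes of one generation are disjoint and have nonempty interior, and \<open>real ^ 'n\<close> is second countable.
\<close>

lemma countable_dyadic_cubes:
  fixes D :: "int \<Rightarrow> (real ^ 'n) set set"
  assumes D: "dyadic_lattice D"
  shows "countable (dyadic_cubes D)"
  unfolding dyadic_cubes_def
proof (intro countable_UN countable_disjoint_nonempty_interior_subsets)
  fix k
  show "disjoint (D k)" using D by (simp add: dyadic_lattice_def partition_on_def)
  fix Q assume Q: "Q \<in> D k" "interior Q = {}"
  obtain x where x: "Q = half_open_cube x (2 powi (- k))" using D Q(1) by (rule dyadic_cubeE)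
  have "box x (x + (\<chi> i. 2 powi (- k))) \<subseteq> interior Q"
    unfolding x by (intro interior_maximal half_open_cube_bounds open_box)
  moreover have "box x (x + (\<chi> i. 2 powi (- k))) \<noteq> {}"
    by (simp add: interval_ne_empty_cart)
  ultimately show "Q = {}" using Q by auto
qed auto

definition cube_at :: "(int \<Rightarrow> (real ^ 'n) set set) \<Rightarrow> real ^ 'n \<Rightarrow> int \<Rightarrow> (real ^ 'n) set" where
  "cube_at D x k = (THE Q. Q \<in> D k \<and> x \<in> Q)"

lemma cube_at:
  assumes "dyadic_lattice D"
  shows "cube_at D x k \<in> D k" "x \<in> cube_at D x k"
    and cube_at_unique: "Q \<in> D k \<Longrightarrow> x \<in> Q \<Longrightarrow> cube_at D x k = Q"
proof -
  have p: "partition_on UNIV (D k)" using assms by (simp add: dyadic_lattice_def)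
  have "\<exists>!Q. Q \<in> D k \<and> x \<in> Q"
    using p unfolding partition_on_def disjoint_def by blast
  then show "cube_at D x k \<in> D k" "x \<in> cube_at D x k"
    "Q \<in> D k \<Longrightarrow> x \<in> Q \<Longrightarrow> cube_at D x k = Q"
    unfolding cube_at_def by (metis (mono_tags, lifting) theI')+
qed

lemma cube_at_Suc_subset:
  assumes D: "dyadic_lattice D"
  shows "cube_at D x (k + 1) \<subseteq> cube_at D x k"
proof -
  obtain C where C: "C \<subseteq> D (k + 1)" "cube_at D x k = \<Union>C"
    using D cube_at(1)[OF D, of x k] unfolding dyadic_lattice_def by metis
  then obtain R where "R \<in> C" "x \<in> R" using cube_at(2)[OF D, of x k] by auto
  with C cube_at_unique[OF D, of R "k+1" x] show ?thesis by auto
qed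

lemma cube_at_antimono:
  assumes D: "dyadic_lattice D" and "i \<le> j"
  shows "cube_at D x (int j) \<subseteq> cube_at D x (int i)"
  using assms(2)
proof (induction rule: dec_induct)
  case (step n)
  then show ?case using cube_at_Suc_subset[OF D, of x "int n"] by (auto simp: add.commute)
qed simp

text \<open>
  Cubes of different generations have different volumes.
\<close>

lemma inj_cube_at:
  fixes D :: "int \<Rightarrow> (real ^ 'n) set set"
  assumes D: "dyadic_lattice D"
  shows "inj (cube_at D x)"
proof (rule injI)
  fix i j assume "cube_at D x i = cube_at D x j"
  then have "((2 powi (- i)) ^ CARD('n) :: real) = (2 powi (- j)) ^ CARD('n)"
    using measure_dyadic_cube[OF D cube_at(1)[OF D]] by metis
  then have "(2 powi (- i) :: real) = 2 powi (- j)"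
    by (subst (asm) power_eq_iff_eq_base) auto
  then show "i = j"
    using power_int_strict_increasing[of "- i" "- j" "2 :: real"]
      power_int_strict_increasing[of "- j" "- i" "2 :: real"]
    by (cases i j rule: linorder_cases) auto
qed

lemma cube_at_layer_nonempty:
  fixes D :: "int \<Rightarrow> (real ^ 'n) set set"
  assumes D: "dyadic_lattice D"
  shows "cube_at D x k - cube_at D x (k + 1) \<noteq> {}"
  using cube_at_Suc_subset[OF D, of x k] injD[OF inj_cube_at[OF D, of x], of k "k + 1"] by auto

text \<open>
  An enumeration by the natural numbers makes the sums over all cubes accessible to measurability and to
  monotone convergence. The chain of cubes around a point shows that there are infinitely many.
\<close>

lemma enumerate_dyadic_cubes:
  fixes D :: "int \<Rightarrow> (real ^ 'n) set set"
  assumes D: "dyadic_lattice D"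
  obtains e :: "nat \<Rightarrow> (real ^ 'n) set" where "bij_betw e UNIV (dyadic_cubes D)"
proof -
  have "range (cube_at D 0) \<subseteq> dyadic_cubes D"
    using cube_at(1)[OF D] by (auto simp: dyadic_cubes_def)
  then have "infinite (dyadic_cubes D)"
    using range_inj_infinite inj_cube_at[OF D, of 0] by (meson finite_imageD infinite_UNIV_int finite_subset)
  then show ?thesis using bij_betw_from_nat_into[OF countable_dyadic_cubes[OF D]] that by blast
qed

section \<open>Square functions along sequences of cubes\<close>

lemma infsum_nat_ennreal: "(\<Sum>\<^sub>\<infinity>i. f i) = (\<Sum>i. f i :: ennreal)"
proof -
  have "(f has_sum (\<Sum>\<^sub>\<infinity>i. f i)) UNIV" by (intro has_sum_infsum nonneg_summable_on_complete) simp
  then show ?thesis by (metis has_sum_imp_sums sums_unique)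
qed

lemma square_function_family:
  assumes e: "inj e" "range e \<subseteq> dyadic_cubes D"
    and c: "\<And>Q. Q \<in> dyadic_cubes D \<Longrightarrow> Q \<notin> range e \<Longrightarrow> c Q = 0"
  shows "square_function D c x
    = ennreal_powr (\<Sum>i::nat. ennreal ((c (e i))\<^sup>2 * indicator (e i) x)) (1 / 2)"
proof -
  have "(\<Sum>\<^sub>\<infinity>Q\<in>dyadic_cubes D. ennreal ((c Q)\<^sup>2 * indicator Q x))
      = (\<Sum>\<^sub>\<infinity>Q\<in>range e. ennreal ((c Q)\<^sup>2 * indicator Q x))"
    using e(2) c by (intro infsum_cong_neutral) auto
  also have "\<dots> = (\<Sum>\<^sub>\<infinity>i. ennreal ((c (e i))\<^sup>2 * indicator (e i) x))"
    by (subst infsum_reindex[OF e(1)]) (simp add: o_def)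
  finally show ?thesis by (simp add: square_function_def infsum_nat_ennreal)
qed

lemma Lp_norm_square_function_family:
  assumes e: "inj e" "range e \<subseteq> dyadic_cubes D"
    and c: "\<And>Q. Q \<in> dyadic_cubes D \<Longrightarrow> Q \<notin> range e \<Longrightarrow> c Q = 0"
  shows "Lp_norm M r (square_function D c)
    = ennreal_powr (\<integral>\<^sup>+x. ennreal_powr (\<Sum>i::nat. ennreal ((c (e i))\<^sup>2 * indicator (e i) x)) (r / 2) \<partial>M) (1 / r)"
proof -
  have "square_function D c = (\<lambda>x. ennreal_powr (\<Sum>i. ennreal ((c (e i))\<^sup>2 * indicator (e i) x)) (1 / 2))"
    by (intro ext square_function_family assms)
  then show ?thesis by (simp add: Lp_norm_def ennreal_powr_powr)
qed

lemma Lp_norm_square_function_single: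
  assumes "Q \<in> dyadic_cubes D" "Q \<in> sets M" "emeasure M Q < \<infinity>" "0 < r"
  shows "Lp_norm M r (square_function D (\<lambda>R. if R = Q then t else 0))
     = ennreal (\<bar>t\<bar> * measure M Q powr (1 / r))"
proof -
  have sq: "square_function D (\<lambda>R. if R = Q then t else 0) x = ennreal (\<bar>t\<bar> * indicator Q x)" for x
  proof -
    have "(\<Sum>\<^sub>\<infinity>R\<in>dyadic_cubes D. ennreal ((if R = Q then t else 0)\<^sup>2 * indicator R x))
        = (\<Sum>\<^sub>\<infinity>R\<in>{Q}. ennreal (t\<^sup>2 * indicator Q x))"
      using assms(1) by (intro infsum_cong_neutral) auto
    also have "\<dots> = ennreal (t\<^sup>2 * indicator Q x)"
      by (simp only: infsum_finite finite.emptyI finite_insert sum.insert empty_iff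
          not_False_eq_True sum.empty add_0_right)
    finally have "square_function D (\<lambda>R. if R = Q then t else 0) x
        = ennreal_powr (ennreal (t\<^sup>2 * indicator Q x)) (1 / 2)"
      by (simp only: square_function_def)
    then show ?thesis
      by (simp add: ennreal_powr_ennreal powr_half_sqrt split: split_indicator)
  qed
  have "(\<integral>\<^sup>+x. ennreal_powr (ennreal (\<bar>t\<bar> * indicator Q x)) r \<partial>M)
      = (\<integral>\<^sup>+x. ennreal (\<bar>t\<bar> powr r) * indicator Q x \<partial>M)"
    by (intro nn_integral_cong) (auto simp: ennreal_powr_ennreal split: split_indicator)
  also have "\<dots> = ennreal (\<bar>t\<bar> powr r) * emeasure M Q"
    using assms by (simp add: nn_integral_cmult)
  also have "\<dots> = ennreal (\<bar>t\<bar> powr r * measure M Q)"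
    using assms by (simp add: emeasure_eq_ennreal_measure ennreal_mult)
  finally show ?thesis using assms
    by (simp add: Lp_norm_def sq ennreal_powr_ennreal powr_mult powr_powr)
qed

section \<open>Equality of the two constants for \<open>p \<le> 2 \<le> q\<close>\<close>

text \<open>
  Test the quadratic inequality on the family that is \<open>1\<close> at a single cube \<open>Q\<close> and \<open>0\<close> elsewhere, and divide
  by \<open>\<sigma>(Q) powr (1 / p)\<close>. A cube with \<open>\<sigma>(Q) = 0\<close> contributes nothing to the simple constant.
\<close>

lemma simple_le_quadratic:
  fixes D :: "int \<Rightarrow> (real ^ 'n) set set"
  assumes D: "dyadic_lattice D" and pq: "1 < p" "1 < q"
    and M: "radon_measure \<sigma>" "radon_measure w"
  shows "simple_A_const D p q \<sigma> w \<le> quadratic_A_const D p q \<sigma> w"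
  unfolding simple_A_const_def quadratic_A_const_def
proof (intro SUP_least Inf_greatest, clarify)
  fix Q C assume Q: "Q \<in> dyadic_cubes D"
    and C: "\<forall>a. Lp_norm w q (square_function D (\<lambda>Q. a Q * (measure \<sigma> Q / measure lborel Q)))
              \<le> C * Lp_norm \<sigma> p (square_function D a)"
  note reg = dyadic_cube_regular[OF D Q]
  have sets: "Q \<in> sets \<sigma>" "Q \<in> sets w" using reg(2) M by (auto simp: radon_measure_def)
  define s where "s = measure \<sigma> Q"
  define m where "m = measure lborel Q"
  define v where "v = measure w Q"
  have conj: "1 / hoelder_conjugate p = 1 - 1 / p" using pq by (simp add: hoelder_conjugate_def field_simps)
  show "ennreal (measure \<sigma> Q powr (1 / hoelder_conjugate p) * measure w Q powr (1 / q) / measure lborel Q) \<le> C"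
  proof (cases "s = 0")
    case False
    then have s: "0 < s" by (simp add: s_def less_le)
    have m: "0 < m" using reg(1) by (simp add: m_def)
    have "(\<lambda>R. (if R = Q then 1 else 0) * (measure \<sigma> R / measure lborel R)) = (\<lambda>R. if R = Q then s / m else 0)"
      by (auto simp: s_def m_def)
    with C[rule_format, of "\<lambda>R. if R = Q then 1 else 0"]
    have "ennreal (s / m * v powr (1 / q)) \<le> C * ennreal (s powr (1 / p))"
      using Q sets reg(3)[OF M(1)] reg(3)[OF M(2)] pq s m
      by (simp add: Lp_norm_square_function_single s_def m_def v_def)
    then have "ennreal (s / m * v powr (1 / q)) / ennreal (s powr (1 / p)) \<le> C"
      using s by (intro divide_le_posI_ennreal) (auto simp: mult.commute)
    also have "ennreal (s / m * v powr (1 / q)) / ennreal (s powr (1 / p)) = ennreal (s / m * v powr (1 / q) / s powr (1 / p))"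
      using s m by (intro divide_ennreal) auto
    also have "s / m * v powr (1 / q) / s powr (1 / p) = s powr (1 - 1 / p) * v powr (1 / q) / m"
      using s by (simp add: powr_diff)
    finally show ?thesis by (simp add: conj s_def v_def m_def)
  qed (simp add: s_def conj)
qed

text \<open>
  As \<open>q / 2 \<ge> 1\<close>, Minkowski's inequality moves the sum over the cubes out of the norm of \<open>L\<^sup>q(w)\<close>. The simple
  constant then compares the two sums term by term. As \<open>p / 2 \<le> 1\<close>, the reversed Minkowski inequality
  moves the sum back into the norm of \<open>L\<^sup>p(\<sigma>)\<close>.
\<close>

lemma quadratic_le_simple:
  fixes D :: "int \<Rightarrow> (real ^ 'n) set set"
  assumes D: "dyadic_lattice D" and pq: "1 < p" "p \<le> 2" "2 \<le> q"
    and M: "radon_measure \<sigma>" "radon_measure w"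
  shows "quadratic_A_const D p q \<sigma> w \<le> simple_A_const D p q \<sigma> w"
proof (cases "simple_A_const D p q \<sigma> w")
  case (real A)
  obtain e :: "nat \<Rightarrow> (real ^ 'n) set" where e: "bij_betw e UNIV (dyadic_cubes D)"
    using enumerate_dyadic_cubes[OF D] .
  have ed: "e i \<in> dyadic_cubes D" for i using e by (auto simp: bij_betw_def)
  note reg = dyadic_cube_regular[OF D ed]
  have sets: "e i \<in> sets \<sigma>" "e i \<in> sets w" for i using reg(2) M by (auto simp: radon_measure_def)
  have norm: "Lp_norm \<mu> r (square_function D c)
      = ennreal_powr (\<integral>\<^sup>+x. ennreal_powr (\<Sum>i. ennreal ((c (e i))\<^sup>2 * indicator (e i) x)) (r / 2) \<partial>\<mu>) (1 / r)" for \<mu> r c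
    using e by (intro Lp_norm_square_function_family) (auto simp: bij_betw_def)
  define s m v where "s i = measure \<sigma> (e i)" and "m i = measure lborel (e i)" and "v i = measure w (e i)" for i
  have smv: "0 \<le> s i" "0 < m i" "0 \<le> v i" for i using reg(1) by (auto simp: s_def m_def v_def)
  have conj: "1 / hoelder_conjugate p = 1 - 1 / p" using pq by (simp add: hoelder_conjugate_def field_simps)
  have A: "s i powr (1 - 1 / p) * v i powr (1 / q) / m i \<le> A" for i
  proof -
    have "ennreal (s i powr (1 - 1 / p) * v i powr (1 / q) / m i) \<le> ennreal A"
      unfolding real(2)[symmetric] simple_A_const_def s_def v_def m_def conj
      by (rule SUP_upper2[OF ed[of i]]) simp
    then show ?thesis using real(1) by simp
  qed
  have key: "s i / m i * v i powr (1 / q) \<le> A * s i powr (1 / p)" for i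
  proof (cases "s i = 0")
    case False
    with smv(1)[of i] have "0 < s i" by (simp add: less_le)
    then have "s i / m i * v i powr (1 / q) = (s i powr (1 - 1 / p) * v i powr (1 / q) / m i) * s i powr (1 / p)"
      by (simp add: powr_diff)
    also have "\<dots> \<le> A * s i powr (1 / p)" by (intro mult_right_mono A) simp
    finally show ?thesis .
  qed simp
  have "Lp_norm w q (square_function D (\<lambda>Q. a Q * (measure \<sigma> Q / measure lborel Q)))
              \<le> ennreal A * Lp_norm \<sigma> p (square_function D a)" for a
  proof -
    define b where "b i = (a (e i) * (s i / m i))\<^sup>2" for i
    have "Lp_norm w q (square_function D (\<lambda>Q. a Q * (measure \<sigma> Q / measure lborel Q)))
        = ennreal_powr (\<integral>\<^sup>+x. ennreal_powr (\<Sum>i. ennreal (b i * indicator (e i) x)) (q / 2) \<partial>w) (1 / q)"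
      by (simp add: norm b_def s_def m_def)
    also have "\<dots> \<le> ennreal_powr (ennreal_powr (\<Sum>i. ennreal (b i * v i powr (1 / (q / 2)))) (q / 2)) (1 / q)"
      unfolding v_def using pq sets reg(3)[OF M(2)]
      by (intro ennreal_powr_mono Minkowski_sets(1)) (auto simp: b_def)
    also have "\<dots> = ennreal_powr (\<Sum>i. ennreal (b i * v i powr (1 / (q / 2)))) (1 / 2)"
      using pq by (simp add: ennreal_powr_powr)
    also have "\<dots> \<le> ennreal_powr (\<Sum>i. ennreal (A\<^sup>2) * ennreal ((a (e i))\<^sup>2 * s i powr (1 / (p / 2)))) (1 / 2)"
    proof (intro ennreal_powr_mono suminf_le)
      fix i
      have pow2: "t powr (2 / r) = (t powr (1 / r))\<^sup>2" for t r :: real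
        by (simp add: power2_eq_square flip: powr_add)
      have "b i * v i powr (2 / q) = (a (e i))\<^sup>2 * (s i / m i * v i powr (1 / q))\<^sup>2"
        by (simp add: b_def pow2 mult.assoc flip: power_mult_distrib)
      also have "\<dots> \<le> (a (e i))\<^sup>2 * (A * s i powr (1 / p))\<^sup>2"
        using key[of i] smv[of i] by (intro mult_left_mono power_mono mult_nonneg_nonneg) auto
      also have "\<dots> = A\<^sup>2 * ((a (e i))\<^sup>2 * s i powr (2 / p))"
        by (simp add: pow2 power_mult_distrib)
      finally show "ennreal (b i * v i powr (1 / (q / 2))) \<le> ennreal (A\<^sup>2) * ennreal ((a (e i))\<^sup>2 * s i powr (1 / (p / 2)))"
        by (simp add: ennreal_leI flip: ennreal_mult)
    qed auto
    also have "\<dots> = ennreal_powr (ennreal (A\<^sup>2) * (\<Sum>i. ennreal ((a (e i))\<^sup>2 * s i powr (1 / (p / 2))))) (1 / 2)"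
      by simp
    also have "\<dots> = ennreal A * ennreal_powr (\<Sum>i. ennreal ((a (e i))\<^sup>2 * s i powr (1 / (p / 2)))) (1 / 2)"
    proof (cases "A = 0")
      case False
      then show ?thesis using real(1)
        by (subst ennreal_powr_mult_ennreal) (auto simp: powr_half_sqrt)
    qed simp
    also have "ennreal_powr (\<Sum>i. ennreal ((a (e i))\<^sup>2 * s i powr (1 / (p / 2)))) (1 / 2)
        = ennreal_powr (ennreal_powr (\<Sum>i. ennreal ((a (e i))\<^sup>2 * s i powr (1 / (p / 2)))) (p / 2)) (1 / p)"
      using pq by (simp add: ennreal_powr_powr)
    also have "ennreal A * \<dots> \<le> ennreal A * ennreal_powr
        (\<integral>\<^sup>+x. ennreal_powr (\<Sum>i. ennreal ((a (e i))\<^sup>2 * indicator (e i) x)) (p / 2) \<partial>\<sigma>) (1 / p)"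
      unfolding s_def using pq sets reg(3)[OF M(1)]
      by (intro mult_left_mono ennreal_powr_mono Minkowski_sets(2)) auto
    finally show ?thesis by (simp add: norm)
  qed
  then show ?thesis unfolding quadratic_A_const_def real(2) by (intro Inf_lower) auto
qed simp

section \<open>Weighted sums of point masses\<close>

definition weighted_diracs :: "(nat \<Rightarrow> real) \<Rightarrow> (nat \<Rightarrow> 'a::topological_space) \<Rightarrow> 'a measure" where
  "weighted_diracs m x = distr (density (count_space UNIV) (\<lambda>j. ennreal (m j))) borel x"

lemma sets_weighted_diracs [simp, measurable_cong]: "sets (weighted_diracs m x) = sets borel"
  by (simp add: weighted_diracs_def)

lemma nn_integral_weighted_diracs:
  assumes [measurable]: "f \<in> borel_measurable borel"
  shows "(\<integral>\<^sup>+y. f y \<partial>weighted_diracs m x) = (\<Sum>j. ennreal (m j) * f (x j))"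
  unfolding weighted_diracs_def
  by (subst nn_integral_distr) (simp_all add: nn_integral_density nn_integral_count_space_nat)

lemma emeasure_weighted_diracs:
  assumes m: "\<And>j. 0 \<le> m j" and A: "A \<in> sets borel"
  shows "emeasure (weighted_diracs m x) A = (\<Sum>j. ennreal (m j * indicator A (x j)))"
proof -
  have "emeasure (weighted_diracs m x) A = (\<integral>\<^sup>+y. indicator A y \<partial>weighted_diracs m x)"
    using A by simp
  also have "\<dots> = (\<Sum>j. ennreal (m j) * indicator A (x j))"
    using A by (intro nn_integral_weighted_diracs) simp
  also have "\<dots> = (\<Sum>j. ennreal (m j * indicator A (x j)))"
    by (intro suminf_cong) (simp split: split_indicator)
  finally show ?thesis .
qed

lemma summable_mult_indicator:
  fixes m :: "nat \<Rightarrow> real"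
  assumes m: "\<And>j. 0 \<le> m j" "summable m"
  shows "summable (\<lambda>j. m j * indicator A (x j))"
  by (rule summable_comparison_test'[OF m(2), of 0]) (use m(1) in \<open>auto split: split_indicator\<close>)

lemma measure_weighted_diracs:
  assumes m: "\<And>j. 0 \<le> m j" "summable m" and A: "A \<in> sets borel"
  shows "measure (weighted_diracs m x) A = (\<Sum>j. m j * indicator A (x j))"
proof -
  have "emeasure (weighted_diracs m x) A = ennreal (\<Sum>j. m j * indicator A (x j))"
    unfolding emeasure_weighted_diracs[OF m(1) A]
    by (intro suminf_ennreal2 summable_mult_indicator m) (simp add: m)
  then show ?thesis
    by (simp add: measure_def suminf_nonneg summable_mult_indicator m)
qed

lemma emeasure_weighted_diracs_finite:
  assumes m: "\<And>j. 0 \<le> m j" "summable m" and A: "A \<in> sets borel"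
  shows "emeasure (weighted_diracs m x) A < \<infinity>"
proof -
  have "emeasure (weighted_diracs m x) A \<noteq> top"
    unfolding emeasure_weighted_diracs[OF m(1) A]
    by (rule ennreal_suminf_neq_top[OF summable_mult_indicator[OF m]]) (simp add: m)
  then show ?thesis unfolding infinity_ennreal_def top.not_eq_extremum .
qed

lemma radon_weighted_diracs:
  fixes x :: "nat \<Rightarrow> 'a::{second_countable_topology, complete_space}"
  assumes m: "\<And>j. 0 \<le> m j" "summable m"
  shows "radon_measure (weighted_diracs m x)"
proof -
  have "emeasure (weighted_diracs m x) (space (weighted_diracs m x)) \<noteq> \<infinity>"
    using emeasure_weighted_diracs_finite[OF m, of UNIV x]
      sets_eq_imp_space_eq[OF sets_weighted_diracs, of m x] by simp
  note regular = inner_regular[OF sets_weighted_diracs this]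
  show ?thesis
    unfolding radon_measure_def
    by (intro conjI allI impI ballI sets_weighted_diracs emeasure_weighted_diracs_finite m
        regular) (simp_all add: borel_compact)
qed

text \<open>
  Written as a weighted sum with all weight on one index, so that the facts about such sums apply.
\<close>

abbreviation dirac :: "'a::topological_space \<Rightarrow> 'a measure" where
  "dirac x \<equiv> weighted_diracs (\<lambda>j. of_bool (j = 0)) (\<lambda>_. x)"

lemma summable_of_bool_0: "summable (\<lambda>j::nat. of_bool (j = 0) :: real)"
  by (rule summable_finite[of "{0}"]) auto

lemma nn_integral_dirac:
  assumes "f \<in> borel_measurable borel"
  shows "(\<integral>\<^sup>+y. f y \<partial>dirac x) = f x"
  unfolding nn_integral_weighted_diracs[OF assms]
  by (subst suminf_finite[of "{0}"]) auto

lemma measure_dirac: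
  assumes "A \<in> sets borel"
  shows "measure (dirac x) A = indicator A x"
  by (subst measure_weighted_diracs[OF _ summable_of_bool_0 assms])
    (simp, subst suminf_finite[of "{0}"], auto)

lemma radon_dirac: "radon_measure (dirac (x :: 'a::{second_countable_topology, complete_space}))"
  by (intro radon_weighted_diracs summable_of_bool_0) simp

section \<open>A measure with geometrically decaying mass near the origin\<close>

definition atom :: "(int \<Rightarrow> (real ^ 'n) set set) \<Rightarrow> nat \<Rightarrow> real ^ 'n" where
  "atom D j = (SOME y. y \<in> cube_at D 0 (int j) - cube_at D 0 (int (Suc j)))"

lemma atom_in_cube_at_iff:
  fixes D :: "int \<Rightarrow> (real ^ 'n) set set"
  assumes D: "dyadic_lattice D"
  shows "atom D j \<in> cube_at D 0 (int i) \<longleftrightarrow> i \<le> j"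
proof -
  have "\<exists>y. y \<in> cube_at D 0 (int j) - cube_at D 0 (int (Suc j))"
    using cube_at_layer_nonempty[OF D, of 0 "int j"] by (auto simp: add.commute)
  then have a: "atom D j \<in> cube_at D 0 (int j)" "atom D j \<notin> cube_at D 0 (int (Suc j))"
    unfolding atom_def by (metis (mono_tags, lifting) DiffD1 DiffD2 someI_ex)+
  show ?thesis
  proof (cases "i \<le> j")
    case True
    then show ?thesis using a(1) cube_at_antimono[OF D True, of 0] by blast
  next
    case False
    then have "cube_at D 0 (int i) \<subseteq> cube_at D 0 (int (Suc j))"
      by (intro cube_at_antimono D) simp
    then show ?thesis using a(2) False by blast
  qed
qed

text \<open>
  For \<open>t = 2 powr (- N * s)\<close>, the mass of a small cube around the origin is comparable to its volume to the
  power \<open>s\<close>.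
\<close>

definition layer_measure :: "(int \<Rightarrow> (real ^ 'n) set set) \<Rightarrow> real \<Rightarrow> (real ^ 'n) measure" where
  "layer_measure D t = weighted_diracs (\<lambda>j. t ^ j) (atom D)"

lemma radon_layer_measure:
  "0 < t \<Longrightarrow> t < 1 \<Longrightarrow> radon_measure (layer_measure D t)"
  unfolding layer_measure_def by (intro radon_weighted_diracs summable_geometric) auto

lemma layer_measure_le:
  assumes "0 < t" "t < 1" "A \<in> sets borel"
  shows "measure (layer_measure D t) A \<le> 1 / (1 - t)"
proof -
  have "(\<Sum>j. t ^ j * indicator A (atom D j)) \<le> (\<Sum>j. t ^ j)"
    using assms by (intro suminf_le summable_mult_indicator summable_geometric) (auto split: split_indicator)
  then show ?thesis
    unfolding layer_measure_def using assms
    by (subst measure_weighted_diracs) (auto simp: summable_geometric suminf_geometric)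
qed

lemma layer_measure_cube_at:
  fixes D :: "int \<Rightarrow> (real ^ 'n) set set"
  assumes D: "dyadic_lattice D" and t: "0 < t" "t < 1"
  shows "measure (layer_measure D t) (cube_at D 0 (int k)) = t ^ k / (1 - t)"
proof -
  have "cube_at D 0 (int k) \<in> sets borel"
    using dyadic_cube_regular(2)[OF D] cube_at(1)[OF D] by (auto simp: dyadic_cubes_def)
  then have "measure (layer_measure D t) (cube_at D 0 (int k))
      = (\<Sum>j. t ^ j * indicator (cube_at D 0 (int k)) (atom D j))"
    unfolding layer_measure_def using t by (intro measure_weighted_diracs summable_geometric) auto
  also have "\<dots> = (\<Sum>j. t ^ k * t ^ j)"
  proof -
    have "summable (\<lambda>j. t ^ j * indicator (cube_at D 0 (int k)) (atom D j))"
      using t by (intro summable_mult_indicator summable_geometric) auto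
    from suminf_split_initial_segment[OF this, of k] show ?thesis
      by (simp add: indicator_def atom_in_cube_at_iff[OF D] power_add mult.commute)
  qed
  also have "\<dots> = t ^ k * (1 / (1 - t))"
    using t by (subst suminf_mult) (auto simp: summable_geometric suminf_geometric)
  finally show ?thesis by simp
qed

lemma power_powr_swap: "0 < x \<Longrightarrow> (x ^ i) powr r = (x powr r) ^ i" for x r :: real
  by (induction i) (simp_all add: powr_mult)

lemma measure_cube_at_nat:
  fixes D :: "int \<Rightarrow> (real ^ 'n) set set"
  assumes D: "dyadic_lattice D"
  shows "measure lborel (cube_at D x (int k)) = ((1 / 2) ^ CARD('n)) ^ k"
  using measure_dyadic_cube[OF D cube_at(1)[OF D], of x "int k"]
  by (simp add: power_int_minus power_one_over inverse_eq_divide flip: power_mult)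

lemma powr_half_power_less_one:
  "0 < s \<Longrightarrow> ((1 / 2) ^ CARD('n::finite)) powr s < (1 :: real)"
  using powr_less_mono2[of s "(1 / 2) ^ CARD('n)" "1 :: real"]
    power_strict_decreasing[of 0 "CARD('n)" "1 / 2 :: real"] by simp

text \<open>
  For cubes of side at most \<open>1\<close> this is the exact geometric series; larger cubes have volume at least \<open>1\<close>,
  and the total mass is finite.
\<close>

lemma layer_measure_growth:
  fixes D :: "int \<Rightarrow> (real ^ 'n) set set"
  assumes D: "dyadic_lattice D" and s: "0 < s" and Q: "Q \<in> dyadic_cubes D" "0 \<in> Q"
  defines "t \<equiv> ((1 / 2) ^ CARD('n)) powr s"
  shows "measure (layer_measure D t) Q powr (1 / s) \<le> (1 / (1 - t)) powr (1 / s) * measure lborel Q"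
proof -
  have t: "0 < t" "t < 1"
    using powr_half_power_less_one[where 'n='n, OF s] by (simp_all add: t_def)
  from Q obtain k where "Q \<in> D k" by (auto simp: dyadic_cubes_def)
  with Q cube_at_unique[OF D] have k: "Q = cube_at D 0 k" by metis
  show ?thesis
  proof (cases "0 \<le> k")
    case True
    then obtain n where n: "k = int n" by (metis nonneg_int_cases)
    have "(t ^ n / (1 - t)) powr (1 / s) = (1 / (1 - t)) powr (1 / s) * (t powr (1 / s)) ^ n"
      using t by (simp add: powr_divide power_powr_swap)
    also have "t powr (1 / s) = (1 / 2) ^ CARD('n)"
      using s by (simp add: t_def powr_powr)
    finally show ?thesis
      by (simp only: k n layer_measure_cube_at[OF D t] measure_cube_at_nat[OF D])
  next
    case False
    have one: "1 \<le> ((2 powi (- k)) ^ CARD('n) :: real)"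
      using False by (intro one_le_power one_le_power_int) auto
    have "measure (layer_measure D t) Q powr (1 / s) \<le> (1 / (1 - t)) powr (1 / s) * 1"
      using s t layer_measure_le[OF t dyadic_cube_regular(2)[OF D Q(1)]] by (simp add: powr_mono2)
    also have "\<dots> \<le> (1 / (1 - t)) powr (1 / s) * measure lborel Q"
      using one measure_dyadic_cube[OF D \<open>Q \<in> D k\<close>] by (intro mult_left_mono) auto
    finally show ?thesis .
  qed
qed

section \<open>Square functions along the chain of cubes containing the origin\<close>

lemma simple_A_const_finite:
  assumes "\<And>Q. Q \<in> dyadic_cubes D \<Longrightarrow>
    measure \<sigma> Q powr (1 / hoelder_conjugate p) * measure w Q powr (1 / q) / measure lborel Q \<le> B"
  shows "simple_A_const D p q \<sigma> w < \<infinity>"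
proof -
  have "simple_A_const D p q \<sigma> w \<le> ennreal B"
    unfolding simple_A_const_def by (intro SUP_least ennreal_leI assms)
  then show ?thesis by (simp add: le_less_trans)
qed

lemma quadratic_A_const_infinite:
  assumes "Lp_norm w q (square_function D (\<lambda>Q. a Q * (measure \<sigma> Q / measure lborel Q))) = \<infinity>"
    and "Lp_norm \<sigma> p (square_function D a) < \<infinity>"
  shows "quadratic_A_const D p q \<sigma> w = \<infinity>"
  unfolding quadratic_A_const_def
proof (rule antisym[OF _ Inf_greatest], simp, clarify)
  fix C
  assume "\<forall>a. Lp_norm w q (square_function D (\<lambda>Q. a Q * (measure \<sigma> Q / measure lborel Q)))
              \<le> C * Lp_norm \<sigma> p (square_function D a)"
  then have "C * Lp_norm \<sigma> p (square_function D a) = \<infinity>"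
    using assms(1) by (metis infinity_ennreal_def top.extremum_unique)
  then show "\<infinity> \<le> C" using assms(2) by (auto simp: ennreal_mult_eq_top_iff)
qed

text \<open>
  The coefficients \<open>\<alpha>\<close> placed on the cubes of generation \<open>0, 1, 2, \<dots>\<close> that contain the origin.
\<close>

definition chain_family :: "(int \<Rightarrow> (real ^ 'n) set set) \<Rightarrow> (nat \<Rightarrow> real) \<Rightarrow> (real ^ 'n) set \<Rightarrow> real" where
  "chain_family D \<alpha> Q = (if \<exists>i. Q = cube_at D 0 (int i) then \<alpha> (THE i. Q = cube_at D 0 (int i)) else 0)"

lemma chain_family_cube_at:
  fixes D :: "int \<Rightarrow> (real ^ 'n) set set"
  assumes D: "dyadic_lattice D"
  shows "chain_family D \<alpha> (cube_at D 0 (int i)) = \<alpha> i"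
proof -
  have "(THE j. cube_at D 0 (int i) = cube_at D 0 (int j)) = i"
    by (intro the_equality refl) (auto dest: injD[OF inj_cube_at[OF D]])
  then show ?thesis by (auto simp: chain_family_def)
qed

lemma Lp_norm_chain:
  fixes D :: "int \<Rightarrow> (real ^ 'n) set set"
  assumes D: "dyadic_lattice D"
  shows "Lp_norm M r (square_function D (\<lambda>Q. chain_family D \<alpha> Q * \<beta> Q))
    = ennreal_powr (\<integral>\<^sup>+x. ennreal_powr (\<Sum>i. ennreal ((\<alpha> i * \<beta> (cube_at D 0 (int i)))\<^sup>2
        * indicator (cube_at D 0 (int i)) x)) (r / 2) \<partial>M) (1 / r)"
proof -
  have "inj (\<lambda>i. cube_at D 0 (int i))"
    by (auto intro!: injI dest!: injD[OF inj_cube_at[OF D]])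
  moreover have "range (\<lambda>i. cube_at D 0 (int i)) \<subseteq> dyadic_cubes D"
    using cube_at(1)[OF D] by (auto simp: dyadic_cubes_def)
  ultimately show ?thesis
    by (subst Lp_norm_square_function_family[where e = "\<lambda>i. cube_at D 0 (int i)"])
      (auto simp: chain_family_cube_at[OF D], auto simp: chain_family_def)
qed

lemma measurable_chain_square [measurable]:
  fixes D :: "int \<Rightarrow> (real ^ 'n) set set"
  assumes D: "dyadic_lattice D"
  shows "(\<lambda>x. ennreal_powr (\<Sum>i. ennreal (c i * indicator (cube_at D 0 (int i)) x)) r) \<in> borel_measurable borel"
proof -
  have [measurable]: "cube_at D 0 (int i) \<in> sets borel" for i
    using dyadic_cube_regular(2)[OF D] cube_at(1)[OF D] by (auto simp: dyadic_cubes_def)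
  show ?thesis by measurable
qed

text \<open>
  At the origin all cubes of the chain count, so a point mass there sees an \<open>\<ell>\<^sup>2\<close> norm of the coefficients.
\<close>

lemma Lp_norm_dirac_chain:
  fixes D :: "int \<Rightarrow> (real ^ 'n) set set"
  assumes D: "dyadic_lattice D" and r: "0 < r"
  shows "Lp_norm (dirac 0) r (square_function D (\<lambda>Q. chain_family D \<alpha> Q * \<beta> Q))
    = ennreal_powr (\<Sum>i. ennreal ((\<alpha> i * \<beta> (cube_at D 0 (int i)))\<^sup>2)) (1 / 2)"
  unfolding Lp_norm_chain[OF D] using r
  by (subst nn_integral_dirac[OF measurable_chain_square[OF D]])
     (simp add: cube_at(2)[OF D] ennreal_powr_powr)

text \<open>
  The \<open>j\<close>-th atom lies exactly in the first \<open>j + 1\<close> cubes of the chain.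
\<close>

lemma Lp_norm_layer_chain:
  fixes D :: "int \<Rightarrow> (real ^ 'n) set set"
  assumes D: "dyadic_lattice D" and t: "0 < t"
  shows "Lp_norm (layer_measure D t) r (square_function D (\<lambda>Q. chain_family D \<alpha> Q * \<beta> Q))
    = ennreal_powr (\<Sum>j. ennreal (t ^ j * (\<Sum>i\<le>j. (\<alpha> i * \<beta> (cube_at D 0 (int i)))\<^sup>2) powr (r / 2))) (1 / r)"
proof -
  define c where "c i = (\<alpha> i * \<beta> (cube_at D 0 (int i)))\<^sup>2" for i
  have inner: "(\<Sum>i. ennreal (c i * indicator (cube_at D 0 (int i)) (atom D j))) = ennreal (\<Sum>i\<le>j. c i)" for j
    by (subst suminf_finite[of "{..j}"]) (auto simp: atom_in_cube_at_iff[OF D] c_def)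
  have "0 \<le> (\<Sum>i\<le>j. c i)" for j by (simp add: c_def sum_nonneg)
  then show ?thesis
    unfolding Lp_norm_chain[OF D] layer_measure_def c_def[symmetric]
    by (subst nn_integral_weighted_diracs[OF measurable_chain_square[OF D]])
      (use t in \<open>simp add: inner ennreal_powr_ennreal flip: ennreal_mult\<close>)
qed

section \<open>The two counterexamples\<close>

lemma suminf_ennreal_harmonic: "0 < c \<Longrightarrow> (\<Sum>i. ennreal (c / real (Suc i))) = \<infinity>"
proof (rule ccontr)
  assume c: "0 < c" and "(\<Sum>i. ennreal (c / real (Suc i))) \<noteq> \<infinity>"
  then have "summable (\<lambda>i. c * (1 / real (Suc i)))"
    by (intro summable_suminf_not_top) auto
  then have "summable (\<lambda>i. 1 / real (Suc i))" using c by (subst (asm) summable_cmult_iff) auto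
  then have "summable (\<lambda>i. inverse (real i))"
    by (subst (asm) summable_Suc_iff[of "\<lambda>i. 1 / real i"]) (simp add: inverse_eq_divide)
  then show False using not_summable_harmonic[where 'a = real] by blast
qed

lemma summable_Suc_powr: "1 < s \<Longrightarrow> summable (\<lambda>i. real (Suc i) powr (- s))"
  by (subst summable_Suc_iff[of "\<lambda>i. real i powr (- s)"]) (simp add: summable_real_powr_iff)

text \<open>
  A geometrically growing sum is controlled by its last term: since \<open>j + 1 \<le> (i + 1) (j - i + 1)\<close>, the term
  of index \<open>i\<close> is at most \<open>(j - i + 1) / \<rho> ^ (j - i)\<close> times the last one, and these factors are summable.
\<close>

lemma geometric_harmonic_sum_le:
  fixes \<rho> :: real
  assumes \<rho>: "1 < \<rho>"
  shows "(\<Sum>i\<le>j. \<rho> ^ i / real (Suc i)) \<le> 1 / (1 - 1 / \<rho>)\<^sup>2 * (\<rho> ^ j / real (Suc j))"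
proof -
  have sums: "(\<lambda>n. real (Suc n) * (1 / \<rho>) ^ n) sums (1 / (1 - 1 / \<rho>)\<^sup>2)"
    using \<rho> by (intro geometric_deriv_sums) auto
  have term_le: "\<rho> ^ i / real (Suc i) \<le> real (Suc (j - i)) * (1 / \<rho>) ^ (j - i) * (\<rho> ^ j / real (Suc j))"
    if "i \<le> j" for i
  proof -
    define d where "d = j - i"
    have d: "j = i + d" using that by (simp add: d_def)
    have "real (Suc i + d) \<le> real (Suc i) * real (Suc d)"
      unfolding of_nat_mult[symmetric] of_nat_le_iff by simp
    then have "1 / real (Suc i) \<le> real (Suc d) / real (Suc j)"
      by (simp add: d field_simps)
    then have "\<rho> ^ i * (1 / real (Suc i)) \<le> \<rho> ^ i * (real (Suc d) / real (Suc j))"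
      using \<rho> by (intro mult_left_mono) auto
    also have "\<dots> = real (Suc d) * (1 / \<rho>) ^ d * (\<rho> ^ j / real (Suc j))"
      using \<rho> unfolding d by (simp add: power_add power_divide)
    finally show ?thesis by (simp add: d_def)
  qed
  have "(\<Sum>i\<le>j. real (Suc (j - i)) * (1 / \<rho>) ^ (j - i)) = (\<Sum>i\<le>j. real (Suc i) * (1 / \<rho>) ^ i)"
    by (rule sum.reindex_bij_witness[of _ "\<lambda>i. j - i" "\<lambda>i. j - i"]) auto
  also have "\<dots> \<le> 1 / (1 - 1 / \<rho>)\<^sup>2"
    using \<rho> sum_le_suminf[OF sums_summable[OF sums], of "{..j}"] sums_unique[OF sums] by auto
  finally have coeff_le: "(\<Sum>i\<le>j. real (Suc (j - i)) * (1 / \<rho>) ^ (j - i)) \<le> 1 / (1 - 1 / \<rho>)\<^sup>2" .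
  have "(\<Sum>i\<le>j. \<rho> ^ i / real (Suc i))
      \<le> (\<Sum>i\<le>j. real (Suc (j - i)) * (1 / \<rho>) ^ (j - i)) * (\<rho> ^ j / real (Suc j))"
    unfolding sum_distrib_right by (intro sum_mono term_le) simp
  also have "\<dots> \<le> 1 / (1 - 1 / \<rho>)\<^sup>2 * (\<rho> ^ j / real (Suc j))"
    using \<rho> by (intro mult_right_mono coeff_le) auto
  finally show ?thesis .
qed

text \<open>
  In terms of suitably normalised coefficients \<open>c\<^sub>i\<close>, the point mass sees their \<open>\<ell>\<^sup>2\<close> norm,
  while the geometric decay of the layers makes the norm in \<open>L\<^sup>p(\<sigma>)\<close> comparable to an \<open>\<ell>\<^sup>p\<close> norm. For \<open>p > 2\<close> a sequence such as \<open>c\<^sub>i = (i + 1) powr (- 1 / 2)\<close> lies in \<open>\<ell>\<^sup>p\<close> but not in \<open>\<ell>\<^sup>2\<close>.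
\<close>

lemma counterexample_large_p:
  fixes D :: "int \<Rightarrow> (real ^ 'n) set set"
  assumes D: "dyadic_lattice D" and p: "2 < p" and q: "1 < q"
  defines "t \<equiv> ((1 / 2) ^ CARD('n)) powr hoelder_conjugate p"
  shows "simple_A_const D p q (layer_measure D t) (dirac 0) < \<infinity>"
    and "quadratic_A_const D p q (layer_measure D t) (dirac 0) = \<infinity>"
proof -
  define \<theta> :: real where "\<theta> = (1 / 2) ^ CARD('n)"
  define s where "s = hoelder_conjugate p"
  have \<theta>: "0 < \<theta>" "\<theta> < 1" 
    using power_strict_decreasing[of 0 "CARD('n)" "1/2::real"] by (auto simp: \<theta>_def)
  have s: "0 < s" "1 / s = 1 - 1 / p" using p by (auto simp: s_def hoelder_conjugate_def field_simps)
  have t_def': "t = \<theta> powr s" by (simp add: t_def \<theta>_def s_def)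
  have t: "0 < t" "t < 1" using powr_half_power_less_one[where 'n='n, OF s(1)] \<theta> by (simp_all add: t_def' \<theta>_def)
  show "simple_A_const D p q (layer_measure D t) (dirac 0) < \<infinity>"
  proof (rule simple_A_const_finite)
    fix Q assume Q: "Q \<in> dyadic_cubes D"
    note reg = dyadic_cube_regular[OF D Q]
    show "measure (layer_measure D t) Q powr (1 / hoelder_conjugate p) * measure (dirac 0) Q powr (1 / q)
        / measure lborel Q \<le> (1 / (1 - t)) powr (1 / s)"
    proof (cases "0 \<in> Q")
      case True
      then show ?thesis
        using layer_measure_growth[OF D s(1) Q True] reg(1)
        by (simp add: measure_dirac[OF reg(2)] s_def t_def field_simps)
    qed (simp add: measure_dirac[OF reg(2)])
  qed
  \<comment> \<open>With this ratio, \<open>\<rho> ^ j\<close> to the power \<open>p / 2\<close> cancels the mass \<open>t ^ j\<close> of the \<open>j\<close>-th atom, and the squared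
      density \<open>(\<sigma>(Q) / |Q|)\<^sup>2\<close> of the \<open>i\<close>-th cube cancels \<open>\<rho> ^ i\<close> up to a constant.\<close>
  define \<rho> where "\<rho> = t powr (- 2 / p)"
  have \<rho>: "1 < \<rho>" using t p powr_less_mono2_neg[of "- 2 / p" t 1] by (simp add: \<rho>_def)
  have \<rho>p: "\<rho> powr (p / 2) = 1 / t" unfolding \<rho>_def powr_powr using t p by (simp add: powr_minus_divide)
  have \<rho>t: "\<rho> * (t / \<theta>)\<^sup>2 = 1"
  proof -
    have "t powr (1 / s) = \<theta>" using s(1) \<theta> by (simp add: t_def' powr_powr)
    then have "\<theta>\<^sup>2 = (t powr (1 / s)) powr 2" using \<theta> by simp
    also have "\<dots> = t powr (2 * (1 - 1 / p))" by (simp only: powr_powr s(2) mult.commute)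
    also have "\<dots> = t powr (2 - 2 / p)" by (simp add: algebra_simps)
    also have "\<dots> = t\<^sup>2 * \<rho>" using t by (simp add: \<rho>_def powr_diff powr_minus_divide)
    finally show ?thesis using \<theta> t \<rho> by (simp add: power_divide)
  qed
  define \<alpha> where "\<alpha> i = sqrt (\<rho> ^ i / real (Suc i))" for i
  have \<alpha>: "(\<alpha> i)\<^sup>2 = \<rho> ^ i / real (Suc i)" for i using \<rho> by (simp add: \<alpha>_def)
  show "quadratic_A_const D p q (layer_measure D t) (dirac 0) = \<infinity>"
  proof (rule quadratic_A_const_infinite[where a = "chain_family D \<alpha>"])
    have "(\<alpha> i * (measure (layer_measure D t) (cube_at D 0 (int i)) / measure lborel (cube_at D 0 (int i))))\<^sup>2
        = (1 / (1 - t))\<^sup>2 / real (Suc i)" for i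
    proof -
      have "(\<alpha> i * (measure (layer_measure D t) (cube_at D 0 (int i)) / measure lborel (cube_at D 0 (int i))))\<^sup>2
          = (\<alpha> i)\<^sup>2 * ((t / \<theta>) ^ i * (1 / (1 - t)))\<^sup>2"
        by (simp add: layer_measure_cube_at[OF D t] measure_cube_at_nat[OF D] \<theta>_def power_mult_distrib power_divide)
      also have "\<dots> = (\<rho> * (t / \<theta>)\<^sup>2) ^ i * ((1 / (1 - t))\<^sup>2 / real (Suc i))"
        unfolding \<alpha> power_mult_distrib by (simp add: mult.commute flip: power_mult)
      finally show ?thesis by (simp add: \<rho>t)
    qed
    moreover have "(\<Sum>i. ennreal ((1 / (1 - t))\<^sup>2 / real (Suc i))) = \<infinity>"
      using t by (intro suminf_ennreal_harmonic) simp
    moreover have "0 < q" using q by simp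
    ultimately show "Lp_norm (dirac 0) q (square_function D (\<lambda>Q. chain_family D \<alpha> Q *
        (measure (layer_measure D t) Q / measure lborel Q))) = \<infinity>"
      by (simp only: Lp_norm_dirac_chain[OF D] ennreal_powr_top)
    have bound: "t ^ j * (\<Sum>i\<le>j. (\<alpha> i * 1)\<^sup>2) powr (p / 2)
        \<le> (1 / (1 - 1 / \<rho>)\<^sup>2) powr (p / 2) * real (Suc j) powr (- (p / 2))" for j
    proof -
      define C where "C = 1 / (1 - 1 / \<rho>)\<^sup>2"
      have C: "0 \<le> C" by (simp add: C_def)
      have "(\<Sum>i\<le>j. (\<alpha> i * 1)\<^sup>2) powr (p / 2) \<le> (C * (\<rho> ^ j / real (Suc j))) powr (p / 2)"
        using p \<rho> geometric_harmonic_sum_le[OF \<rho>, of j]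
        by (intro powr_mono2) (auto simp: \<alpha> C_def intro!: sum_nonneg)
      also have "\<dots> = C powr (p / 2) * ((1 / t) ^ j * real (Suc j) powr (- (p / 2)))"
        using C \<rho> by (simp add: powr_mult powr_divide power_powr_swap \<rho>p powr_minus_divide)
      finally have "t ^ j * (\<Sum>i\<le>j. (\<alpha> i * 1)\<^sup>2) powr (p / 2)
          \<le> t ^ j * (C powr (p / 2) * ((1 / t) ^ j * real (Suc j) powr (- (p / 2))))"
        using t by (intro mult_left_mono) auto
      also have "\<dots> = C powr (p / 2) * real (Suc j) powr (- (p / 2))"
        using t by (simp add: power_divide)
      finally show ?thesis by (simp add: C_def)
    qed
    have "summable (\<lambda>j. (1 / (1 - 1 / \<rho>)\<^sup>2) powr (p / 2) * real (Suc j) powr (- (p / 2)))"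
      using p by (intro summable_mult summable_Suc_powr) auto
    then have "summable (\<lambda>j. t ^ j * (\<Sum>i\<le>j. (\<alpha> i * 1)\<^sup>2) powr (p / 2))"
      by (rule summable_comparison_test'[where N = 0]) (use bound t in auto)
    then have "(\<Sum>j. ennreal (t ^ j * (\<Sum>i\<le>j. (\<alpha> i * 1)\<^sup>2) powr (p / 2))) < \<infinity>"
      using ennreal_suminf_neq_top t by (simp add: less_top[symmetric])
    then show "Lp_norm (layer_measure D t) p (square_function D (chain_family D \<alpha>)) < \<infinity>"
      using Lp_norm_layer_chain[OF D t(1), of p \<alpha> "\<lambda>_. 1"] by simp
  qed
qed

text \<open>
  The dual situation: the point mass now stands on the right and gives the \<open>\<ell>\<^sup>2\<close> norm of the coefficients, while
  the left-hand side dominates their \<open>\<ell>\<^sup>q\<close> norm. The sequence \<open>(i + 1) powr (- 1 / q)\<close> lies in \<open>\<ell>\<^sup>2\<close>, because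
  \<open>q < 2\<close>, but not in \<open>\<ell>\<^sup>q\<close>.
\<close>

lemma counterexample_small_q:
  fixes D :: "int \<Rightarrow> (real ^ 'n) set set"
  assumes D: "dyadic_lattice D" and p: "1 < p" and q: "1 < q" "q < 2"
  defines "t \<equiv> ((1 / 2) ^ CARD('n)) powr q"
  shows "simple_A_const D p q (dirac 0) (layer_measure D t) < \<infinity>"
    and "quadratic_A_const D p q (dirac 0) (layer_measure D t) = \<infinity>"
proof -
  define \<theta> :: real where "\<theta> = (1 / 2) ^ CARD('n)"
  have \<theta>: "0 < \<theta>" "\<theta> < 1" 
    using power_strict_decreasing[of 0 "CARD('n)" "1/2::real"] by (auto simp: \<theta>_def)
  have t_def': "t = \<theta> powr q" by (simp add: t_def \<theta>_def)
  have t: "0 < t" "t < 1" using powr_half_power_less_one[where 'n='n, of q] \<theta> q by (simp_all add: t_def' \<theta>_def)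
  show "simple_A_const D p q (dirac 0) (layer_measure D t) < \<infinity>"
  proof (rule simple_A_const_finite)
    fix Q assume Q: "Q \<in> dyadic_cubes D"
    note reg = dyadic_cube_regular[OF D Q]
    show "measure (dirac 0) Q powr (1 / hoelder_conjugate p) * measure (layer_measure D t) Q powr (1 / q)
        / measure lborel Q \<le> (1 / (1 - t)) powr (1 / q)"
    proof (cases "0 \<in> Q")
      case True
      then show ?thesis
        using layer_measure_growth[OF D _ Q True, of q] reg(1) q
        by (simp add: measure_dirac[OF reg(2)] t_def field_simps)
    qed (simp add: measure_dirac[OF reg(2)])
  qed
  define \<alpha> where "\<alpha> i = real (Suc i) powr (- (1 / q))" for i
  show "quadratic_A_const D p q (dirac 0) (layer_measure D t) = \<infinity>"
  proof (rule quadratic_A_const_infinite[where a = "chain_family D \<alpha>"])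
    let ?c = "\<lambda>i. (\<alpha> i * (measure (dirac 0) (cube_at D 0 (int i)) / measure lborel (cube_at D 0 (int i))))\<^sup>2"
    have c: "?c i = (\<alpha> i / \<theta> ^ i)\<^sup>2" for i
    proof -
      have "cube_at D 0 (int i) \<in> sets borel"
        using dyadic_cube_regular(2)[OF D] cube_at(1)[OF D] by (auto simp: dyadic_cubes_def)
      then show ?thesis
        by (simp add: measure_dirac cube_at(2)[OF D] measure_cube_at_nat[OF D] \<theta>_def)
    qed
    \<comment> \<open>Only the last summand is kept; up to the factor \<open>1 / (j + 1)\<close> its power cancels the mass of the atom.\<close>
    have "1 / real (Suc j) \<le> t ^ j * (\<Sum>i\<le>j. ?c i) powr (q / 2)" for j
    proof -
      have "((\<alpha> j / \<theta> ^ j)\<^sup>2) powr (q / 2) = (\<alpha> j / \<theta> ^ j) powr q"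
        using \<theta> by (simp add: \<alpha>_def powr_powr flip: powr_numeral)
      also have "\<dots> = 1 / real (Suc j) / t ^ j"
      proof -
        have "\<alpha> j powr q = 1 / real (Suc j)"
          unfolding \<alpha>_def powr_powr using q by (simp add: powr_minus_divide)
        moreover have "0 \<le> \<alpha> j" by (simp add: \<alpha>_def)
        ultimately show ?thesis using \<theta> by (simp add: powr_divide power_powr_swap t_def')
      qed
      finally have "1 / real (Suc j) = t ^ j * (?c j) powr (q / 2)" using t c[of j] by simp
      also have "\<dots> \<le> t ^ j * (\<Sum>i\<le>j. ?c i) powr (q / 2)"
        using t q by (intro mult_left_mono powr_mono2 member_le_sum) auto
      finally show ?thesis .
    qed
    then have "(\<Sum>j. ennreal (1 / real (Suc j))) \<le> (\<Sum>j. ennreal (t ^ j * (\<Sum>i\<le>j. ?c i) powr (q / 2)))"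
      by (intro suminf_le ennreal_leI) auto
    then have "(\<Sum>j. ennreal (t ^ j * (\<Sum>i\<le>j. ?c i) powr (q / 2))) = \<infinity>"
      by (simp only: suminf_ennreal_harmonic zero_less_one infinity_ennreal_def top_unique)
    then show "Lp_norm (layer_measure D t) q (square_function D (\<lambda>Q. chain_family D \<alpha> Q *
        (measure (dirac 0) Q / measure lborel Q))) = \<infinity>"
      by (simp only: Lp_norm_layer_chain[OF D t(1)] ennreal_powr_top)
    have "(\<alpha> i * 1)\<^sup>2 = real (Suc i) powr (- (2 / q))" for i
      by (simp add: \<alpha>_def powr_powr flip: powr_numeral)
    then have "summable (\<lambda>i. (\<alpha> i * 1)\<^sup>2)" using q summable_Suc_powr[of "2 / q"] by simp
    then have "(\<Sum>i. ennreal ((\<alpha> i * 1)\<^sup>2)) < \<infinity>"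
      using ennreal_suminf_neq_top by (simp add: less_top[symmetric])
    then show "Lp_norm (dirac 0) p (square_function D (chain_family D \<alpha>)) < \<infinity>"
      using p Lp_norm_dirac_chain[OF D, of p \<alpha> "\<lambda>_. 1"] by simp
  qed
qed

section \<open>The comparison theorem\<close>

theorem lemma6p1:
  fixes D :: "int \<Rightarrow> (real ^ 'n) set set" and p q :: real
  assumes "dyadic_lattice D" and "1 < p" and "1 < q"
  shows "(p \<le> 2 \<and> 2 \<le> q \<longrightarrow>
            (\<forall>\<sigma> w. radon_measure \<sigma> \<longrightarrow> radon_measure w \<longrightarrow>
               simple_A_const D p q \<sigma> w = quadratic_A_const D p q \<sigma> w)) \<and>
         (2 < p \<or> q < 2 \<longrightarrow>
            (\<exists>\<sigma> w. radon_measure \<sigma> \<and> radon_measure w \<and>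
               simple_A_const D p q \<sigma> w < \<infinity> \<and> quadratic_A_const D p q \<sigma> w = \<infinity>))"
proof (intro conjI impI allI)
  fix \<sigma> w :: "(real ^ 'n) measure"
  assume "p \<le> 2 \<and> 2 \<le> q" "radon_measure \<sigma>" "radon_measure w"
  then show "simple_A_const D p q \<sigma> w = quadratic_A_const D p q \<sigma> w"
    using simple_le_quadratic[OF assms] quadratic_le_simple[OF assms(1,2)] by (auto intro: antisym)
next
  assume "2 < p \<or> q < 2"
  then show "\<exists>\<sigma> w. radon_measure \<sigma> \<and> radon_measure w \<and>
      simple_A_const D p q \<sigma> w < \<infinity> \<and> quadratic_A_const D p q \<sigma> w = \<infinity>"
  proof
    assume p: "2 < p"
    let ?s = "hoelder_conjugate p"
    have "0 < ?s" using p by (simp add: hoelder_conjugate_def)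
    then have "radon_measure (layer_measure D (((1 / 2) ^ CARD('n)) powr ?s))"
      by (intro radon_layer_measure powr_half_power_less_one) simp_all
    then show ?thesis
      using radon_dirac counterexample_large_p[OF assms(1) p assms(3)] by blast
  next
    assume q: "q < 2"
    have "radon_measure (layer_measure D (((1 / 2) ^ CARD('n)) powr q))"
      using assms(3) by (intro radon_layer_measure powr_half_power_less_one) simp_all
    then show ?thesis
      using radon_dirac counterexample_small_q[OF assms(1,2,3) q] by blast
  qed
qed

end
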